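(* Let $n$ individuals be partitioned into two groups $P_1,P_2$ of sizes $s_1$ and $s_2$ respectively, with payoffs as in the context. Under the assumption that $c<y_3$, the efficient structure consists of (i) the disjoint union of cliques if and only if $$0\le F_{12}\le\frac{c\,\delta}{y_1(s_1)\,y_1(s_2)};$$ (ii) minimally connected cliques if and only if $$\frac{c\,\delta}{y_1(s_1)\,y_1(s_2)}\le F_{12}\le\frac{2c}{y_2(s_2)+y_2(s_1)+(s_1+s_2-4)\,\delta y_3};$$ (iii) redundantly connected cliques if and only if $$\frac{2c}{y_2(s_2)+y_2(s_1)+(s_1+s_2-4)\,\delta y_3}\le F_{12}\le\frac{c}{y_3};$$ (iv) maximally connected cliques if and only if $$\frac{c}{y_3}\le F_{12}\le 1.$$
   Context: Setting. $V$ is a set of $n$ individuals partitioned into two disjoint groups $P_1,P_2$ with sizes $s_\gamma=|P_\gamma|\ge 3$. $F\in\mathbb{R}^{2\times 2}$ is a symmetric matrix with entries in $[0,1]$ and diagonal entries equal to $1$. For $i\in P_\alpha$, $j\in P_\beta$, $i\ne j$, put $\hat F_{ij}=F_{\alpha\beta}$, and $\hat F_{ii}=0$. Constants: $\delta$ with $0<\delta<1$ is the one-hop benefit, and $c$ is the cost of each link. A network is a set $\mathcal{E}$ of undirected edges between distinct individuals of $V$; $d_{ij}(\mathcal{E})$ is the graph distance ($\infty$ if there is no path, with $\delta^{\infty}=0$), and $N_i(\mathcal{E})$ is the set of neighbors of $i$. The payoff of $i$ is $U_i(\mathcal{E})=\sum_{k\in V}\hat F_{ik}\,\delta^{d_{ik}(\mathcal{E})}-c\,|N_i(\mathcal{E})|$.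 The value (social welfare) is $v(\mathcal{E})=\sum_{i\in V}U_i(\mathcal{E})$; $\mathcal{E}$ is an efficient structure if it maximizes $v$ over all possible edge sets on $V$. Thresholds: $y_1(s)=\delta+(s-1)\delta^2$, $y_2(s)=(1-\delta)y_1(s)=\delta-\delta^2+(s-1)\delta^2-(s-1)\delta^3$, $y_3=\delta-\delta^2$. An interconnection is an edge between an individual of $P_1$ and an individual of $P_2$. In all structures named in the claim both groups are cliques (every two distinct individuals of the same group are linked). Disjoint union: there is no interconnection. Minimally connected: there is exactly one interconnection. Redundantly connected: there are at least two interconnections. Maximally connected: all possible interconnections between the two groups are present.
   Formalization: In (iii), "redundantly connected" is taken to exclude maximally connected cliques; with "at least two interconnections" alone, (iii) fails, e.g. for F12 = 1 and 0 < c < y3, where the maximally connected structure is efficient although F12 > c/y3. *)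

theory Defs
  imports "HOL-Analysis.Analysis" "HOL-Library.Extended_Nat"
begin

section \<open>Networks and graph distance\<close>

definition all_links :: "'a set \<Rightarrow> 'a set set" where
  "all_links V = {{i, j} | i j. i \<in> V \<and> j \<in> V \<and> i \<noteq> j}"

definition network :: "'a set \<Rightarrow> 'a set set \<Rightarrow> bool" where
  "network V E \<longleftrightarrow> E \<subseteq> all_links V"

definition adj :: "'a set set \<Rightarrow> ('a \<times> 'a) set" where
  "adj E = {(i, j). {i, j} \<in> E}"

definition neighbors :: "'a set set \<Rightarrow> 'a \<Rightarrow> 'a set" where
  "neighbors E i = {j. {i, j} \<in> E}"

text \<open>The length of a shortest walk; the infimum of the empty set of \<open>enat\<close> is \<open>\<infinity>\<close>.\<close>

definition graph_dist :: "'a set set \<Rightarrow> 'a \<Rightarrow> 'a \<Rightarrow> enat" where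
  "graph_dist E i j = (INF k \<in> {k. (i, j) \<in> adj E ^^ k}. enat k)"

definition enat_power :: "real \<Rightarrow> enat \<Rightarrow> real" where
  "enat_power \<delta> d = (case d of enat k \<Rightarrow> \<delta> ^ k | \<infinity> \<Rightarrow> 0)"

section \<open>Payoffs and efficiency\<close>

text \<open>The groups are indexed by the type \<open>2\<close>. An individual outside \<open>P1\<close> is taken to be
  in group 2; the definition is only used on \<open>P1 \<union> P2\<close> with \<open>P1\<close>, \<open>P2\<close> disjoint.\<close>

definition group_of :: "'a set \<Rightarrow> 'a \<Rightarrow> 2" where
  "group_of P1 i = (if i \<in> P1 then 1 else 2)"

definition F_hat :: "real ^ 2 ^ 2 \<Rightarrow> 'a set \<Rightarrow> 'a \<Rightarrow> 'a \<Rightarrow> real" where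
  "F_hat F P1 i j = (if i = j then 0 else F $ group_of P1 i $ group_of P1 j)"

definition payoff ::
  "real ^ 2 ^ 2 \<Rightarrow> real \<Rightarrow> real \<Rightarrow> 'a set \<Rightarrow> 'a set \<Rightarrow> 'a set set \<Rightarrow> 'a \<Rightarrow> real" where
  "payoff F \<delta> c P1 P2 E i =
     (\<Sum>k \<in> P1 \<union> P2. F_hat F P1 i k * enat_power \<delta> (graph_dist E i k))
       - c * real (card (neighbors E i))"

definition welfare ::
  "real ^ 2 ^ 2 \<Rightarrow> real \<Rightarrow> real \<Rightarrow> 'a set \<Rightarrow> 'a set \<Rightarrow> 'a set set \<Rightarrow> real" where
  "welfare F \<delta> c P1 P2 E = (\<Sum>i \<in> P1 \<union> P2. payoff F \<delta> c P1 P2 E i)"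

definition efficient ::
  "real ^ 2 ^ 2 \<Rightarrow> real \<Rightarrow> real \<Rightarrow> 'a set \<Rightarrow> 'a set \<Rightarrow> 'a set set \<Rightarrow> bool" where
  "efficient F \<delta> c P1 P2 E \<longleftrightarrow>
     network (P1 \<union> P2) E \<and>
     (\<forall>E'. network (P1 \<union> P2) E' \<longrightarrow> welfare F \<delta> c P1 P2 E' \<le> welfare F \<delta> c P1 P2 E)"

section \<open>Thresholds\<close>

definition y1 :: "real \<Rightarrow> nat \<Rightarrow> real" where
  "y1 \<delta> s = \<delta> + (real s - 1) * \<delta>\<^sup>2"

definition y2 :: "real \<Rightarrow> nat \<Rightarrow> real" where
  "y2 \<delta> s = (1 - \<delta>) * y1 \<delta> s"

definition y3 :: "real \<Rightarrow> real" where
  "y3 \<delta> = \<delta> - \<delta>\<^sup>2"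

section \<open>Two cliques and their interconnections\<close>

definition clique :: "'a set \<Rightarrow> 'a set set \<Rightarrow> bool" where
  "clique P E \<longleftrightarrow> all_links P \<subseteq> E"

definition possible_interconnections :: "'a set \<Rightarrow> 'a set \<Rightarrow> 'a set set" where
  "possible_interconnections P1 P2 = {{i, j} | i j. i \<in> P1 \<and> j \<in> P2}"

definition interconnections :: "'a set \<Rightarrow> 'a set \<Rightarrow> 'a set set \<Rightarrow> 'a set set" where
  "interconnections P1 P2 E = E \<inter> possible_interconnections P1 P2"

definition disjoint_union_of_cliques :: "'a set \<Rightarrow> 'a set \<Rightarrow> 'a set set \<Rightarrow> bool" where
  "disjoint_union_of_cliques P1 P2 E \<longleftrightarrow>
     clique P1 E \<and> clique P2 E \<and> interconnections P1 P2 E = {}"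

definition minimally_connected_cliques :: "'a set \<Rightarrow> 'a set \<Rightarrow> 'a set set \<Rightarrow> bool" where
  "minimally_connected_cliques P1 P2 E \<longleftrightarrow>
     clique P1 E \<and> clique P2 E \<and> card (interconnections P1 P2 E) = 1"

text \<open>This includes the maximally connected structure.\<close>

definition redundantly_connected_cliques :: "'a set \<Rightarrow> 'a set \<Rightarrow> 'a set set \<Rightarrow> bool" where
  "redundantly_connected_cliques P1 P2 E \<longleftrightarrow>
     clique P1 E \<and> clique P2 E \<and> card (interconnections P1 P2 E) \<ge> 2"

definition maximally_connected_cliques :: "'a set \<Rightarrow> 'a set \<Rightarrow> 'a set set \<Rightarrow> bool" where
  "maximally_connected_cliques P1 P2 E \<longleftrightarrow>
     clique P1 E \<and> clique P2 E \<and> possible_interconnections P1 P2 \<subseteq> E"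

end

theory Submission
  imports Defs
begin

text \<open>
  Since \<open>c < \<delta> - \<delta>\<^sup>2\<close>, adding a missing link inside a group strictly raises welfare, so an
  efficient network consists of both cliques and a set \<open>I \<subseteq> P1 \<times> P2\<close> of interconnections. A pair
  \<open>(i, k)\<close> is then at distance 1 if it is in \<open>I\<close>, at distance 2 if it is not but one of its
  members is an endpoint of a link in \<open>I\<close>, and otherwise at distance 3 (or \<open>\<infinity>\<close> if \<open>I\<close> is
  empty). Welfare therefore depends only on the number \<open>m\<close> of interconnections and the numbers
  \<open>a\<close>, \<open>b\<close> of their endpoints. With \<open>T\<^sub>1 = y\<^sub>1(s\<^sub>1) y\<^sub>1(s\<^sub>2) / \<delta>\<close> and
  \<open>T\<^sub>2 = (1 + (s\<^sub>1 + s\<^sub>2 - 3) \<delta>) y\<^sub>3\<close>, the first interconnection gains \<open>F\<^sub>1\<^sub>2 T\<^sub>1 - c\<close>; every further one gains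
  at most \<open>F\<^sub>1\<^sub>2 T\<^sub>2 - c\<close> on average, attained by a second link disjoint from the first; and every further one
  gains at least \<open>F\<^sub>1\<^sub>2 y\<^sub>3 - c\<close>, attained by the last possible one. As \<open>y\<^sub>3 \<le> T\<^sub>2 \<le> T\<^sub>1\<close>, the four
  cases are read off from the position of \<open>c\<close> among these multiples of \<open>F\<^sub>1\<^sub>2\<close>, for either sign of \<open>c\<close>.
\<close>

section \<open>Graph distance\<close>

lemma mem_all_links: "{i, j} \<in> all_links P \<longleftrightarrow> i \<in> P \<and> j \<in> P \<and> i \<noteq> j"
  by (auto simp: all_links_def doubleton_eq_iff)

lemma all_links_mono: "P \<subseteq> Q \<Longrightarrow> all_links P \<subseteq> all_links Q"
  by (auto simp: all_links_def)

lemma adj_iff: "(i, j) \<in> adj E \<longleftrightarrow> {i, j} \<in> E"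
  by (simp add: adj_def)

lemma network_link_neq: "network V E \<Longrightarrow> {i, j} \<in> E \<Longrightarrow> i \<noteq> j"
  by (auto simp: network_def all_links_def doubleton_eq_iff)

lemma network_link_mem: "network V E \<Longrightarrow> {i, j} \<in> E \<Longrightarrow> i \<in> V \<and> j \<in> V"
  by (auto simp: network_def all_links_def doubleton_eq_iff)

lemma graph_dist_le: "(i, j) \<in> adj E ^^ k \<Longrightarrow> graph_dist E i j \<le> enat k"
  unfolding graph_dist_def by (rule INF_lower) simp

lemma graph_dist_ge:
  assumes "\<And>k. (i, j) \<in> adj E ^^ k \<Longrightarrow> n \<le> k"
  shows "enat n \<le> graph_dist E i j"
  unfolding graph_dist_def using assms by (auto intro: INF_greatest)

lemma graph_dist_eq:
  assumes "(i, j) \<in> adj E ^^ n" and "\<And>k. k < n \<Longrightarrow> (i, j) \<notin> adj E ^^ k"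
  shows "graph_dist E i j = enat n"
  using graph_dist_le[OF assms(1)] graph_dist_ge[of i j E n] assms(2)
  by (meson antisym not_le_imp_less)

lemma graph_dist_antimono:
  assumes "E \<subseteq> E'"
  shows "graph_dist E' i j \<le> graph_dist E i j"
proof -
  have "adj E ^^ k \<subseteq> adj E' ^^ k" for k
    using assms by (induction k) (auto simp: adj_def)
  then show ?thesis
    unfolding graph_dist_def by (intro INF_superset_mono) auto
qed

lemma graph_dist_link: "i \<noteq> j \<Longrightarrow> {i, j} \<in> E \<Longrightarrow> graph_dist E i j = 1"
  using graph_dist_eq[where n = 1] by (simp add: adj_iff one_enat_def)

lemma graph_dist_no_link:
  assumes "i \<noteq> j" and "{i, j} \<notin> E"
  shows "enat 2 \<le> graph_dist E i j"
proof (rule graph_dist_ge)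
  fix k assume k: "(i, j) \<in> adj E ^^ k"
  have "k \<noteq> 0" "k \<noteq> 1"
    using k assms by (auto simp: adj_iff intro!: gr0I)
  then show "2 \<le> k" by linarith
qed

lemma adj_sym: "(i, j) \<in> adj E ^^ k \<Longrightarrow> (j, i) \<in> adj E ^^ k"
proof (induction k arbitrary: i j)
  case (Suc k)
  then obtain z where "(i, z) \<in> adj E ^^ k" and z: "(z, j) \<in> adj E" by auto
  then have "(z, i) \<in> adj E ^^ k" "(j, z) \<in> adj E"
    using Suc.IH by (auto simp: adj_iff insert_commute)
  then show ?case by (rule relpow_Suc_I2[rotated])
qed auto

lemma graph_dist_commute: "graph_dist E i j = graph_dist E j i"
proof -
  have "{k. (i, j) \<in> adj E ^^ k} = {k. (j, i) \<in> adj E ^^ k}"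
    using adj_sym by fast
  then show ?thesis by (simp add: graph_dist_def)
qed

lemma enat_power_antimono:
  assumes "0 \<le> \<delta>" "\<delta> \<le> 1" "d \<le> d'"
  shows "enat_power \<delta> d' \<le> enat_power \<delta> d"
  using assms by (cases d; cases d') (simp_all add: enat_power_def power_decreasing)

section \<open>Efficient networks contain both cliques\<close>

locale two_groups =
  fixes P1 P2 :: "'a set" and F :: "real ^ 2 ^ 2" and \<delta> c :: real
  assumes finite_P1: "finite P1" and finite_P2: "finite P2"
    and disjoint: "P1 \<inter> P2 = {}"
    and card_P1: "card P1 \<ge> 3" and card_P2: "card P2 \<ge> 3"
    and F_sym: "transpose F = F"
    and F_nonneg: "\<And>\<alpha> \<beta>. 0 \<le> F $ \<alpha> $ \<beta>"
    and F_diag: "\<And>\<alpha>. F $ \<alpha> $ \<alpha> = 1"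
    and \<delta>_pos: "0 < \<delta>" and \<delta>_less_1: "\<delta> < 1" and c_less: "c < y3 \<delta>"
begin

abbreviation "f \<equiv> F $ 1 $ 2"

abbreviation "s1 \<equiv> real (card P1)"

abbreviation "s2 \<equiv> real (card P2)"

lemma y3_pos: "0 < y3 \<delta>"
  using \<delta>_pos \<delta>_less_1 by (simp add: y3_def power2_eq_square)

text \<open>Contribution of an ordered pair: every link is charged once to each of its ends.\<close>

definition pair_welfare :: "'a set set \<Rightarrow> 'a \<Rightarrow> 'a \<Rightarrow> real" where
  "pair_welfare E i k =
     F_hat F P1 i k * enat_power \<delta> (graph_dist E i k) - (if {i, k} \<in> E then c else 0)"

lemma welfare_eq_sum_pairs:
  assumes "network (P1 \<union> P2) E"
  shows "welfare F \<delta> c P1 P2 E = (\<Sum>i \<in> P1 \<union> P2. \<Sum>k \<in> P1 \<union> P2. pair_welfare E i k)"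
proof -
  have "c * real (card (neighbors E i)) = (\<Sum>k \<in> P1 \<union> P2. if {i, k} \<in> E then c else 0)" for i
  proof -
    have "neighbors E i = {k \<in> P1 \<union> P2. {i, k} \<in> E}"
      using network_link_mem[OF assms] by (auto simp: neighbors_def)
    then show ?thesis
      using finite_P1 finite_P2 by (simp add: sum.inter_filter[symmetric] del: Un_iff)
  qed
  then show ?thesis
    by (simp add: welfare_def payoff_def pair_welfare_def sum_subtractf)
qed

lemma pair_welfare_commute: "pair_welfare E i k = pair_welfare E k i"
proof -
  have "F $ \<alpha> $ \<beta> = F $ \<beta> $ \<alpha>" for \<alpha> \<beta>
    using arg_cong[OF F_sym, of "\<lambda>A. A $ \<alpha> $ \<beta>"] by (simp add: transpose_def)
  then show ?thesis
    by (simp add: pair_welfare_def F_hat_def graph_dist_commute[of E i k] insert_commute)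
qed

lemma welfare_split:
  assumes "network (P1 \<union> P2) E"
  shows "welfare F \<delta> c P1 P2 E =
    (\<Sum>i \<in> P1. \<Sum>k \<in> P1. pair_welfare E i k) + (\<Sum>i \<in> P2. \<Sum>k \<in> P2. pair_welfare E i k)
    + 2 * (\<Sum>i \<in> P1. \<Sum>k \<in> P2. pair_welfare E i k)"
proof -
  have "(\<Sum>i \<in> P2. \<Sum>k \<in> P1. pair_welfare E i k) = (\<Sum>k \<in> P1. \<Sum>i \<in> P2. pair_welfare E k i)"
    by (subst sum.swap) (simp add: pair_welfare_commute)
  then show ?thesis
    by (simp add: welfare_eq_sum_pairs[OF assms] sum.union_disjoint finite_P1 finite_P2 disjoint
        sum.distrib)
qed

text \<open>Two distinct unlinked members of a group are at distance at least 2, so linking them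
  gains at least \<open>y3 \<delta> - c > 0\<close>. All other pairs get no farther apart and cost
  the same.\<close>

lemma pair_welfare_add_cliques:
  fixes i k
  assumes net: "network (P1 \<union> P2) E"
  defines "E' \<equiv> E \<union> all_links P1 \<union> all_links P2"
  shows "pair_welfare E i k \<le> pair_welfare E' i k"
    and "{i, k} \<in> E' - E \<Longrightarrow> pair_welfare E i k < pair_welfare E' i k"
proof -
  have strict: "pair_welfare E i k < pair_welfare E' i k" if new: "{i, k} \<in> E' - E" for i k
  proof -
    have neq: "i \<noteq> k" and same: "group_of P1 i = group_of P1 k"
      using new disjoint by (auto simp: E'_def mem_all_links group_of_def)
    have "enat_power \<delta> (graph_dist E i k) \<le> enat_power \<delta> (enat 2)"
      using graph_dist_no_link[OF neq] new \<delta>_pos \<delta>_less_1 by (intro enat_power_antimono) auto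
    moreover have "enat_power \<delta> (graph_dist E' i k) = \<delta>"
      using graph_dist_link[OF neq] new by (simp add: enat_power_def one_enat_def)
    ultimately show ?thesis
      using new neq same c_less
      by (simp add: pair_welfare_def F_hat_def F_diag y3_def enat_power_def)
  qed
  show "{i, k} \<in> E' - E \<Longrightarrow> pair_welfare E i k < pair_welfare E' i k"
    by (rule strict)
  show "pair_welfare E i k \<le> pair_welfare E' i k"
  proof (cases "{i, k} \<in> E' - E")
    case False
    have "enat_power \<delta> (graph_dist E i k) \<le> enat_power \<delta> (graph_dist E' i k)"
      using \<delta>_pos \<delta>_less_1 by (intro enat_power_antimono graph_dist_antimono) (auto simp: E'_def)
    moreover have "0 \<le> F_hat F P1 i k"
      by (simp add: F_hat_def F_nonneg)
    moreover have "{i, k} \<in> E \<longleftrightarrow> {i, k} \<in> E'"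
      using False by (auto simp: E'_def)
    ultimately show ?thesis
      by (simp add: pair_welfare_def mult_left_mono)
  qed (auto intro: less_imp_le strict)
qed

lemma network_add_cliques:
  "network (P1 \<union> P2) E \<Longrightarrow> network (P1 \<union> P2) (E \<union> all_links P1 \<union> all_links P2)"
  by (simp add: network_def all_links_mono)

lemma welfare_add_cliques:
  assumes net: "network (P1 \<union> P2) E"
  shows "welfare F \<delta> c P1 P2 E \<le> welfare F \<delta> c P1 P2 (E \<union> all_links P1 \<union> all_links P2)"
  unfolding welfare_eq_sum_pairs[OF net] welfare_eq_sum_pairs[OF network_add_cliques[OF net]]
  by (intro sum_mono pair_welfare_add_cliques net)

text \<open>Adding the missing links raises the term of some pair strictly and lowers none.\<close>

lemma efficient_imp_cliques:
  assumes eff: "efficient F \<delta> c P1 P2 E"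
  shows "clique P1 E \<and> clique P2 E"
proof (rule ccontr)
  assume "\<not> (clique P1 E \<and> clique P2 E)"
  then obtain e where e: "e \<in> all_links P1 \<union> all_links P2" "e \<notin> E"
    unfolding clique_def by blast
  moreover from e(1) obtain i k where "e = {i, k}"
    unfolding all_links_def by blast
  ultimately have ik: "{i, k} \<in> all_links P1 \<union> all_links P2" "{i, k} \<notin> E"
    by simp_all
  let ?E' = "E \<union> all_links P1 \<union> all_links P2"
  have net: "network (P1 \<union> P2) E"
    using eff by (simp add: efficient_def)
  have mem: "i \<in> P1 \<union> P2" "k \<in> P1 \<union> P2"
    using ik(1) by (auto simp: mem_all_links)
  have "(\<Sum>k \<in> P1 \<union> P2. pair_welfare E i k) < (\<Sum>k \<in> P1 \<union> P2. pair_welfare ?E' i k)"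
  proof (rule sum_strict_mono_ex1)
    show "\<exists>k \<in> P1 \<union> P2. pair_welfare E i k < pair_welfare ?E' i k"
      using ik mem by (intro bexI[of _ k] pair_welfare_add_cliques(2) net) auto
  qed (simp_all add: finite_P1 finite_P2 pair_welfare_add_cliques(1) net)
  then have "(\<Sum>i \<in> P1 \<union> P2. \<Sum>k \<in> P1 \<union> P2. pair_welfare E i k) <
      (\<Sum>i \<in> P1 \<union> P2. \<Sum>k \<in> P1 \<union> P2. pair_welfare ?E' i k)"
    using mem(1) finite_P1 finite_P2
    by (intro sum_strict_mono_ex1) (auto intro!: sum_mono pair_welfare_add_cliques(1) net)
  then have "welfare F \<delta> c P1 P2 E < welfare F \<delta> c P1 P2 ?E'"
    unfolding welfare_eq_sum_pairs[OF net] welfare_eq_sum_pairs[OF network_add_cliques[OF net]] .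
  then show False
    using eff network_add_cliques[OF net] unfolding efficient_def by (meson not_le)
qed

section \<open>Welfare of two joined cliques\<close>

text \<open>With ordered pairs, the endpoints in the two groups are the images of \<open>I\<close>
  under \<open>fst\<close> and \<open>snd\<close>.\<close>

definition joined_cliques :: "('a \<times> 'a) set \<Rightarrow> 'a set set" where
  "joined_cliques I = all_links P1 \<union> all_links P2 \<union> (\<lambda>(i, k). {i, k}) ` I"

lemma mem_joined_cliques:
  "{i, k} \<in> joined_cliques I \<longleftrightarrow>
    i \<noteq> k \<and> (i \<in> P1 \<and> k \<in> P1 \<or> i \<in> P2 \<and> k \<in> P2) \<or> (i, k) \<in> I \<or> (k, i) \<in> I"
proof -
  have "{i, k} \<in> (\<lambda>(i, k). {i, k}) ` I \<longleftrightarrow> (i, k) \<in> I \<or> (k, i) \<in> I"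
    by (force simp: image_iff doubleton_eq_iff)
  then show ?thesis
    by (auto simp: joined_cliques_def mem_all_links)
qed

lemma mem_joined_cliques_cross:
  assumes "I \<subseteq> P1 \<times> P2" "i \<in> P1" "k \<in> P2"
  shows "{i, k} \<in> joined_cliques I \<longleftrightarrow> (i, k) \<in> I"
  using assms disjoint by (auto simp: mem_joined_cliques)

lemma network_joined_cliques:
  assumes "I \<subseteq> P1 \<times> P2"
  shows "network (P1 \<union> P2) (joined_cliques I)"
proof -
  have "(\<lambda>(i, k). {i, k}) ` I \<subseteq> all_links (P1 \<union> P2)"
    using assms disjoint by (force simp: mem_all_links)
  then show ?thesis
    by (simp add: network_def joined_cliques_def all_links_mono)
qed

lemma network_eq_joined_cliques:
  assumes net: "network (P1 \<union> P2) E" and "clique P1 E" "clique P2 E"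
  obtains I where "I \<subseteq> P1 \<times> P2" "E = joined_cliques I"
proof
  let ?I = "{(i, k) \<in> P1 \<times> P2. {i, k} \<in> E}"
  show "?I \<subseteq> P1 \<times> P2" by auto
  show "E = joined_cliques ?I"
  proof
    show "joined_cliques ?I \<subseteq> E"
      using assms by (auto simp: joined_cliques_def clique_def)
    show "E \<subseteq> joined_cliques ?I"
    proof
      fix e assume "e \<in> E"
      moreover from this obtain i k where "e = {i, k}" "i \<in> P1 \<union> P2" "k \<in> P1 \<union> P2" "i \<noteq> k"
        using net by (auto simp: network_def all_links_def)
      ultimately show "e \<in> joined_cliques ?I"
        by (auto simp: mem_joined_cliques insert_commute)
    qed
  qed
qed

text \<open>Written as corrections to the value at distance 2, so that sums over all pairs become
  counts: a link adds \<open>y3 \<delta>\<close>, and distance 3 loses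
  \<open>\<delta> * y3 \<delta>\<close>.\<close>

lemma proximity_joined_cliques:
  assumes I: "I \<subseteq> P1 \<times> P2" and i: "i \<in> P1" and k: "k \<in> P2"
  shows "enat_power \<delta> (graph_dist (joined_cliques I) i k) =
    (if I = {} then 0
     else \<delta>\<^sup>2 + (if (i, k) \<in> I then y3 \<delta> else 0)
       - (if (i, k) \<in> (P1 - fst ` I) \<times> (P2 - snd ` I) then \<delta> * y3 \<delta> else 0))"
proof -
  let ?A = "adj (joined_cliques I)"
  have neq: "i \<noteq> k" using i k disjoint by auto
  have A: "(u, v) \<in> ?A \<longleftrightarrow>
      u \<noteq> v \<and> (u \<in> P1 \<and> v \<in> P1 \<or> u \<in> P2 \<and> v \<in> P2) \<or> (u, v) \<in> I \<or> (v, u) \<in> I" for u v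
    by (simp add: adj_iff mem_joined_cliques)
  have direct: "(i, k) \<in> ?A \<longleftrightarrow> (i, k) \<in> I"
    using mem_joined_cliques_cross[OF I i k] by (simp add: adj_iff)
  consider (empty) "I = {}" | (link) "(i, k) \<in> I"
    | (one_end) "(i, k) \<notin> I" "i \<in> fst ` I \<or> k \<in> snd ` I"
    | (no_end) "I \<noteq> {}" "i \<notin> fst ` I" "k \<notin> snd ` I"
    by blast
  then show ?thesis
  proof cases
    case empty
    \<comment> \<open>Without interconnections no walk leaves \<open>P1\<close>.\<close>
    have "(i, x) \<in> ?A ^^ n \<Longrightarrow> x \<in> P1" for n x
    proof (induction n arbitrary: x)
      case (Suc n)
      then obtain z where "z \<in> P1" "(z, x) \<in> ?A" by auto
      then show ?case using disjoint A[of z x] unfolding empty by auto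
    qed (simp add: i)
    then have "{n. (i, k) \<in> ?A ^^ n} = {}"
      using k disjoint by auto
    then show ?thesis
      using empty by (simp add: graph_dist_def enat_power_def top_enat_def)
  next
    case link
    then have "graph_dist (joined_cliques I) i k = 1"
      using neq by (intro graph_dist_link) (simp_all add: mem_joined_cliques)
    moreover have "I \<noteq> {}" "i \<in> fst ` I" using link by force+
    ultimately show ?thesis
      using link by (simp add: enat_power_def one_enat_def y3_def)
  next
    case one_end
    \<comment> \<open>The far end \<open>z\<close> of an interconnection at \<open>i\<close> or
      \<open>k\<close> is the middle vertex; a clique supplies the other link.\<close>
    have "\<exists>z. (i, z) \<in> ?A \<and> (z, k) \<in> ?A"
      using one_end(2)
    proof
      assume "i \<in> fst ` I"
      then obtain z where "(i, z) \<in> I" by force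
      then show ?thesis using one_end(1) I k by (auto simp: A intro!: exI[of _ z])
    next
      assume "k \<in> snd ` I"
      then obtain z where "(z, k) \<in> I" by force
      then show ?thesis using one_end(1) I i by (auto simp: A intro!: exI[of _ z])
    qed
    then have "(i, k) \<in> ?A ^^ 2"
      by (auto simp: numeral_2_eq_2)
    moreover have "(i, k) \<notin> ?A ^^ n" if "n < 2" for n
    proof -
      have "n = 0 \<or> n = 1" using that by auto
      then show ?thesis using neq direct one_end(1) by auto
    qed
    ultimately have "graph_dist (joined_cliques I) i k = enat 2"
      by (rule graph_dist_eq)
    moreover have "I \<noteq> {}" using one_end by auto
    ultimately show ?thesis
      using one_end by (auto simp: enat_power_def)
  next
    case no_end
    have no_link: "(i, z) \<notin> I" "(z, k) \<notin> I" for z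
      using no_end(2,3) by force+
    obtain u v where uv: "(u, v) \<in> I" using no_end(1) by auto
    \<comment> \<open>Any interconnection \<open>(u, v)\<close> gives a walk of length 3;
      \<open>i\<close> and \<open>k\<close> are not endpoints, so they differ from \<open>u\<close>
      and \<open>v\<close>.\<close>
    have "(i, u) \<in> ?A" "(u, v) \<in> ?A" "(v, k) \<in> ?A"
      using uv I i k no_link by (auto simp: A)
    then have "(i, k) \<in> ?A ^^ 3"
      by (auto simp: numeral_3_eq_3)
    moreover have "(i, k) \<notin> ?A ^^ n" if "n < 3" for n
    proof -
      have "n = 0 \<or> n = 1 \<or> n = Suc 1" using that by auto
      moreover have "(i, k) \<notin> ?A ^^ Suc 1"
      proof
        assume "(i, k) \<in> ?A ^^ Suc 1"
        then obtain z where z: "(i, z) \<in> ?A" "(z, k) \<in> ?A" by auto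
        \<comment> \<open>As neither \<open>i\<close> nor \<open>k\<close> is an endpoint, a middle
          vertex would belong to both groups.\<close>
        have "z \<in> P1" using z(1) no_link(1)[of z] I i disjoint unfolding A by blast
        moreover have "z \<in> P2" using z(2) no_link(2)[of z] I k disjoint unfolding A by blast
        ultimately show False using disjoint by blast
      qed
      ultimately show ?thesis using neq direct no_link by auto
    qed
    ultimately have "graph_dist (joined_cliques I) i k = enat 3"
      by (rule graph_dist_eq)
    moreover have "\<delta> ^ 3 = \<delta>\<^sup>2 - \<delta> * y3 \<delta>"
      by (simp add: y3_def power2_eq_square power3_eq_cube algebra_simps)
    ultimately show ?thesis
      using no_end i k no_link by (simp add: enat_power_def)
  qed
qed

text \<open>The sum of \<open>pair_welfare\<close> over \<open>P1 \<times> P2\<close>; the product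
  of differences counts the pairs at distance 3. For empty \<open>I\<close> all distances across the
  groups are infinite, hence the separate case.\<close>

definition gain :: "('a \<times> 'a) set \<Rightarrow> real" where
  "gain I = (if I = {} then 0
     else f * (s1 * s2 * \<delta>\<^sup>2 + real (card I) * y3 \<delta>
            - (s1 - real (card (fst ` I))) * (s2 - real (card (snd ` I))) * \<delta> * y3 \<delta>)
          - c * real (card I))"

lemma sum_cross_pair_welfare:
  assumes I: "I \<subseteq> P1 \<times> P2"
  shows "(\<Sum>i \<in> P1. \<Sum>k \<in> P2. pair_welfare (joined_cliques I) i k) = gain I"
proof -
  let ?N = "(P1 - fst ` I) \<times> (P2 - snd ` I)"
  let ?S = "P1 \<times> P2"
  have finI: "finite I" using I finite_P1 finite_P2 finite_subset by blast
  have finS: "finite ?S" using finite_P1 finite_P2 by auto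
  have subs: "fst ` I \<subseteq> P1" "snd ` I \<subseteq> P2" using I by auto
  have cardN: "real (card ?N) = (s1 - real (card (fst ` I))) * (s2 - real (card (snd ` I)))"
    using subs finite_P1 finite_P2 finI
    by (simp add: card_cartesian_product card_Diff_subset of_nat_diff card_mono)
  have indicator: "(\<Sum>p \<in> ?S. if p \<in> T then r else 0) = r * real (card T)"
    if "T \<subseteq> ?S" for T and r :: real
    using that finS by (simp add: sum.If_cases Int_absorb1 mult.commute)
  have pair: "pair_welfare (joined_cliques I) i k =
      (if I = {} then 0
       else f * (\<delta>\<^sup>2 + (if (i, k) \<in> I then y3 \<delta> else 0)
              - (if (i, k) \<in> ?N then \<delta> * y3 \<delta> else 0)))
      - (if (i, k) \<in> I then c else 0)" if "i \<in> P1" "k \<in> P2" for i k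
  proof -
    have "F_hat F P1 i k = f"
      using that disjoint by (auto simp: F_hat_def group_of_def)
    then show ?thesis
      using that proximity_joined_cliques[OF I that] mem_joined_cliques_cross[OF I that]
      by (simp add: pair_welfare_def)
  qed
  have "(\<Sum>i \<in> P1. \<Sum>k \<in> P2. pair_welfare (joined_cliques I) i k) =
      (\<Sum>p \<in> ?S. (if I = {} then 0
       else f * (\<delta>\<^sup>2 + (if p \<in> I then y3 \<delta> else 0) - (if p \<in> ?N then \<delta> * y3 \<delta> else 0)))
      - (if p \<in> I then c else 0))"
    unfolding sum.cartesian_product by (intro sum.cong refl) (clarsimp simp only: pair mem_Sigma_iff)
  also have "\<dots> = gain I"
  proof (cases "I = {}")
    case False
    have N: "?N \<subseteq> ?S" by auto
    have "(\<Sum>p \<in> ?S. f * (\<delta>\<^sup>2 + (if p \<in> I then y3 \<delta> else 0) - (if p \<in> ?N then \<delta> * y3 \<delta> else 0))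
        - (if p \<in> I then c else 0)) =
        f * (real (card ?S) * \<delta>\<^sup>2 + y3 \<delta> * real (card I) - \<delta> * y3 \<delta> * real (card ?N))
        - c * real (card I)"
      unfolding sum_subtractf sum_distrib_left[symmetric] sum.distrib
        indicator[OF I] indicator[OF N] by simp
    then show ?thesis
      using False unfolding cardN
      by (simp add: gain_def card_cartesian_product algebra_simps)
  qed (simp add: gain_def)
  finally show ?thesis .
qed

text \<open>Distinct members of a group are at distance 1 for every \<open>I\<close>, so only pairs
  across the groups vary; each is counted in both orders, hence the factor 2.\<close>

lemma welfare_joined_cliques:
  assumes I: "I \<subseteq> P1 \<times> P2"
  shows "welfare F \<delta> c P1 P2 (joined_cliques I) =
    welfare F \<delta> c P1 P2 (joined_cliques {}) + 2 * gain I"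
proof -
  have same_group: "pair_welfare (joined_cliques I) i k = pair_welfare (joined_cliques {}) i k"
    if "i \<in> P1 \<and> k \<in> P1 \<or> i \<in> P2 \<and> k \<in> P2" for i k
  proof (cases "i = k")
    case True
    then show ?thesis
      using network_link_neq[OF network_joined_cliques[OF I], of i k]
        network_link_neq[OF network_joined_cliques[of "{}"], of i k]
      by (auto simp: pair_welfare_def F_hat_def)
  next
    case False
    then have "{i, k} \<in> joined_cliques J" for J
      using that by (simp add: mem_joined_cliques)
    then show ?thesis
      using False by (simp add: pair_welfare_def graph_dist_link)
  qed
  have "gain {} = 0" by (simp add: gain_def)
  then show ?thesis
    using I by (simp add: welfare_split network_joined_cliques sum_cross_pair_welfare
        same_group cong: sum.cong)
qed

section \<open>Efficiency as maximality of \<open>gain\<close>\<close>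

definition optimal :: "('a \<times> 'a) set \<Rightarrow> bool" where
  "optimal I \<longleftrightarrow> I \<subseteq> P1 \<times> P2 \<and> (\<forall>J. J \<subseteq> P1 \<times> P2 \<longrightarrow> gain J \<le> gain I)"

lemma efficient_iff_optimal:
  "efficient F \<delta> c P1 P2 E \<longleftrightarrow> (\<exists>I. optimal I \<and> E = joined_cliques I)"
proof
  assume eff: "efficient F \<delta> c P1 P2 E"
  then obtain I where I: "I \<subseteq> P1 \<times> P2" "E = joined_cliques I"
    using network_eq_joined_cliques[of E] efficient_imp_cliques[OF eff]
    by (auto simp: efficient_def)
  have "gain J \<le> gain I" if "J \<subseteq> P1 \<times> P2" for J
    using eff network_joined_cliques[OF that] welfare_joined_cliques[OF that]
      welfare_joined_cliques[OF I(1)] I(2) by (fastforce simp: efficient_def)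
  then show "\<exists>I. optimal I \<and> E = joined_cliques I"
    using I by (auto simp: optimal_def)
next
  assume "\<exists>I. optimal I \<and> E = joined_cliques I"
  then obtain I where I: "I \<subseteq> P1 \<times> P2" "\<And>J. J \<subseteq> P1 \<times> P2 \<Longrightarrow> gain J \<le> gain I"
    and E: "E = joined_cliques I" by (auto simp: optimal_def)
  have "welfare F \<delta> c P1 P2 E' \<le> welfare F \<delta> c P1 P2 E" if net: "network (P1 \<union> P2) E'" for E'
  proof -
    \<comment> \<open>Completing both groups does not lower welfare, so only networks of the form
      \<open>joined_cliques J\<close> compete.\<close>
    obtain J where J: "J \<subseteq> P1 \<times> P2" "E' \<union> all_links P1 \<union> all_links P2 = joined_cliques J"
    proof (rule network_eq_joined_cliques[OF network_add_cliques[OF net]])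
    qed (auto simp: clique_def)
    show ?thesis
      using welfare_add_cliques[OF net] I(2)[OF J(1)] welfare_joined_cliques[OF J(1)]
        welfare_joined_cliques[OF I(1)] J(2) E by simp
  qed
  then show "efficient F \<delta> c P1 P2 E"
    using network_joined_cliques[OF I(1)] E by (simp add: efficient_def)
qed

lemma optimal_exists: "\<exists>I. optimal I"
proof -
  let ?S = "Pow (P1 \<times> P2)"
  have fin: "finite (gain ` ?S)" using finite_P1 finite_P2 by simp
  then have "Max (gain ` ?S) \<in> gain ` ?S" by (intro Max_in) auto
  then obtain I where "I \<in> ?S" "gain I = Max (gain ` ?S)" by auto
  then show ?thesis
    using fin by (auto simp: optimal_def intro!: exI[of _ I])
qed

text \<open>Lets a candidate be proved optimal by comparison with one set provided by
  \<open>optimal_exists\<close>.\<close>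

lemma optimal_trans: "optimal I \<Longrightarrow> J \<subseteq> P1 \<times> P2 \<Longrightarrow> gain I \<le> gain J \<Longrightarrow> optimal J"
  by (auto simp: optimal_def intro: order_trans)

section \<open>Structures in terms of their interconnections\<close>

lemma cliques_joined_cliques: "clique P1 (joined_cliques I)" "clique P2 (joined_cliques I)"
  by (auto simp: clique_def joined_cliques_def)

lemma possible_interconnections_eq:
  "possible_interconnections P1 P2 = (\<lambda>(i, k). {i, k}) ` (P1 \<times> P2)"
  by (force simp: possible_interconnections_def image_iff)

lemma interconnections_joined_cliques:
  assumes "I \<subseteq> P1 \<times> P2"
  shows "interconnections P1 P2 (joined_cliques I) = (\<lambda>(i, k). {i, k}) ` I"
proof -
  have "interconnections P1 P2 (joined_cliques I) =
      (\<lambda>(i, k). {i, k}) ` {p \<in> P1 \<times> P2. (\<lambda>(i, k). {i, k}) p \<in> joined_cliques I}"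
    by (auto simp: interconnections_def possible_interconnections_eq)
  also have "{p \<in> P1 \<times> P2. (\<lambda>(i, k). {i, k}) p \<in> joined_cliques I} = I"
    using assms mem_joined_cliques_cross[OF assms] by auto
  finally show ?thesis .
qed

text \<open>As the groups are disjoint, an unordered link determines its ordered pair.\<close>

lemma card_interconnections_joined_cliques:
  assumes "I \<subseteq> P1 \<times> P2"
  shows "card (interconnections P1 P2 (joined_cliques I)) = card I"
proof -
  have "inj_on (\<lambda>(i, k). {i, k}) (P1 \<times> P2)"
    using disjoint by (auto simp: inj_on_def doubleton_eq_iff)
  then show ?thesis
    using assms by (simp add: interconnections_joined_cliques card_image inj_on_subset)
qed

lemma disjoint_joined_cliques:
  "I \<subseteq> P1 \<times> P2 \<Longrightarrow> disjoint_union_of_cliques P1 P2 (joined_cliques I) \<longleftrightarrow> I = {}"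
  by (simp add: disjoint_union_of_cliques_def cliques_joined_cliques interconnections_joined_cliques)

lemma minimally_joined_cliques:
  "I \<subseteq> P1 \<times> P2 \<Longrightarrow> minimally_connected_cliques P1 P2 (joined_cliques I) \<longleftrightarrow> card I = 1"
  by (simp add: minimally_connected_cliques_def cliques_joined_cliques
      card_interconnections_joined_cliques)

lemma redundantly_joined_cliques:
  "I \<subseteq> P1 \<times> P2 \<Longrightarrow> redundantly_connected_cliques P1 P2 (joined_cliques I) \<longleftrightarrow> 2 \<le> card I"
  by (simp add: redundantly_connected_cliques_def cliques_joined_cliques
      card_interconnections_joined_cliques)

lemma maximally_joined_cliques:
  assumes "I \<subseteq> P1 \<times> P2"
  shows "maximally_connected_cliques P1 P2 (joined_cliques I) \<longleftrightarrow> I = P1 \<times> P2"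
proof -
  have "maximally_connected_cliques P1 P2 (joined_cliques I) \<longleftrightarrow>
      (\<forall>i \<in> P1. \<forall>k \<in> P2. {i, k} \<in> joined_cliques I)"
    by (auto simp: maximally_connected_cliques_def cliques_joined_cliques
        possible_interconnections_eq)
  also have "\<dots> \<longleftrightarrow> I = P1 \<times> P2"
    using assms mem_joined_cliques_cross[OF assms] by auto
  finally show ?thesis .
qed

section \<open>Optimal interconnections\<close>

text \<open>\<open>c / single_threshold\<close> and \<open>c / double_threshold\<close> are the bounds on \<open>F\<^sub>1\<^sub>2\<close> of the claim; the
  division is avoided because \<open>c\<close> may be negative, which would reverse the order of the quotients.\<close>

definition "single_threshold = y1 \<delta> (card P1) * y1 \<delta> (card P2) / \<delta>"

definition "double_threshold = (1 + (s1 + s2 - 3) * \<delta>) * y3 \<delta>"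

lemma s1_ge: "3 \<le> s1" and s2_ge: "3 \<le> s2"
  using card_P1 card_P2 by auto

lemma y1_eq: "y1 \<delta> s = \<delta> * (1 + (real s - 1) * \<delta>)"
  by (simp add: y1_def power2_eq_square algebra_simps)

text \<open>The total benefit over the pairs across the groups for a single interconnection: one
  pair at distance 1, \<open>s1 + s2 - 2\<close> at distance 2 and
  \<open>(s1 - 1) * (s2 - 1)\<close> at distance 3.\<close>

lemma single_threshold_eq:
  "single_threshold = \<delta> * (1 + (s1 + s2 - 2) * \<delta> + (s1 - 1) * (s2 - 1) * \<delta>\<^sup>2)"
proof -
  have "single_threshold = \<delta> * ((1 + (s1 - 1) * \<delta>) * (1 + (s2 - 1) * \<delta>))"
    using \<delta>_pos by (simp add: single_threshold_def y1_eq)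
  then show ?thesis
    by (simp add: power2_eq_square algebra_simps)
qed

lemma y3_eq: "y3 \<delta> = \<delta> * (1 - \<delta>)"
  by (simp add: y3_def power2_eq_square algebra_simps)

lemma y3_le_double_threshold: "y3 \<delta> \<le> double_threshold"
  using y3_pos \<delta>_pos s1_ge s2_ge by (simp add: double_threshold_def mult_le_cancel_right1)

text \<open>Termwise comparison after \<open>y3 \<delta> \<le> \<delta>\<close>.\<close>

lemma double_le_single_threshold: "double_threshold \<le> single_threshold"
proof -
  have "double_threshold \<le> (1 + (s1 + s2 - 3) * \<delta>) * \<delta>"
    unfolding double_threshold_def
    using \<delta>_pos s1_ge s2_ge by (intro mult_left_mono) (auto simp: y3_def)
  also have "\<dots> \<le> (1 + (s1 + s2 - 2) * \<delta> + (s1 - 1) * (s2 - 1) * \<delta>\<^sup>2) * \<delta>"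
  proof (intro mult_right_mono)
    have "(s1 + s2 - 3) * \<delta> \<le> (s1 + s2 - 2) * \<delta>"
      using \<delta>_pos by (intro mult_right_mono) auto
    moreover have "0 \<le> (s1 - 1) * (s2 - 1) * \<delta>\<^sup>2"
      using s1_ge s2_ge by (intro mult_nonneg_nonneg) auto
    ultimately show "1 + (s1 + s2 - 3) * \<delta> \<le>
        1 + (s1 + s2 - 2) * \<delta> + (s1 - 1) * (s2 - 1) * \<delta>\<^sup>2" by linarith
  qed (use \<delta>_pos in simp)
  finally show ?thesis by (simp add: single_threshold_eq mult.commute)
qed

lemma f_thresholds: "f * y3 \<delta> \<le> f * double_threshold" "f * double_threshold \<le> f * single_threshold"
  using y3_le_double_threshold double_le_single_threshold F_nonneg by (auto intro: mult_left_mono)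

section \<open>Gains from adding and removing interconnections\<close>

lemma gain_empty: "gain {} = 0"
  by (simp add: gain_def)

lemma gain_singleton: "gain {p} = f * single_threshold - c"
  by (simp add: gain_def single_threshold_eq y3_eq power2_eq_square algebra_simps)

text \<open>The second link takes \<open>s1 + s2 - 3\<close> pairs off distance 3, each worth
  \<open>\<delta> * y3 \<delta>\<close>; one of them is the new link itself, which gains a further
  \<open>y3 \<delta>\<close>.\<close>

lemma gain_disjoint_pair:
  assumes "i \<noteq> i'" "k \<noteq> k'"
  shows "gain {(i, k), (i', k')} = gain {p} + (f * double_threshold - c)"
  using assms
  by (simp add: gain_singleton gain_def single_threshold_eq double_threshold_def y3_eq power2_eq_square algebra_simps)

lemma ends_bounds:
  assumes "I \<subseteq> P1 \<times> P2"
  shows "finite I" "card (fst ` I) \<le> card P1" "card (snd ` I) \<le> card P2"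
    "card (fst ` I) \<le> card I" "card (snd ` I) \<le> card I"
proof -
  show fin: "finite I"
    using assms finite_P1 finite_P2 finite_subset by blast
  show "card (fst ` I) \<le> card I" "card (snd ` I) \<le> card I"
    using fin by (simp_all add: card_image_le)
  show "card (fst ` I) \<le> card P1" "card (snd ` I) \<le> card P2"
    using assms finite_P1 finite_P2 by (auto intro!: card_mono)
qed

text \<open>The new link gains at least the step from distance 2 to 1, and the sets of endpoints
  only grow, so the number of pairs at distance 3 does not increase.\<close>

lemma gain_insert:
  assumes I: "I \<subseteq> P1 \<times> P2" "I \<noteq> {}" and p: "p \<in> P1 \<times> P2" "p \<notin> I"
  shows "gain I + (f * y3 \<delta> - c) \<le> gain (insert p I)"
proof -
  let ?J = "insert p I"
  have J: "?J \<subseteq> P1 \<times> P2" using I p by auto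
  have "card (fst ` I) \<le> card (fst ` ?J)" "card (snd ` I) \<le> card (snd ` ?J)"
    using ends_bounds(1)[OF J] by (auto intro!: card_mono simp del: image_insert)
  then have "(s1 - real (card (fst ` ?J))) * (s2 - real (card (snd ` ?J)))
      \<le> (s1 - real (card (fst ` I))) * (s2 - real (card (snd ` I)))"
    using ends_bounds[OF J] ends_bounds[OF I(1)] by (intro mult_mono) auto
  then have "f * ((s1 - real (card (fst ` ?J))) * (s2 - real (card (snd ` ?J))) * (\<delta> * y3 \<delta>))
      \<le> f * ((s1 - real (card (fst ` I))) * (s2 - real (card (snd ` I))) * (\<delta> * y3 \<delta>))"
    using F_nonneg \<delta>_pos y3_pos by (intro mult_left_mono mult_right_mono) auto
  moreover have "card ?J = Suc (card I)"
    using p ends_bounds(1)[OF I(1)] by simp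
  ultimately show ?thesis
    using I(2) by (simp add: gain_def algebra_simps del: image_insert)
qed

text \<open>The missing links are inserted one at a time, none of them at a loss.\<close>

lemma gain_le_full:
  assumes I: "I \<subseteq> P1 \<times> P2" "I \<noteq> {}" and "c \<le> f * y3 \<delta>"
  shows "gain I \<le> gain (P1 \<times> P2)"
proof -
  have "gain I \<le> gain (I \<union> K)" if "finite K" "K \<subseteq> P1 \<times> P2" for K
    using that
  proof (induction K)
    case (insert p K)
    have "gain (I \<union> K) \<le> gain (insert p (I \<union> K))"
      using gain_insert[of "I \<union> K" p] insert.prems I assms(3) by (cases "p \<in> I \<union> K")
        (auto simp: insert_absorb)
    then show ?case using insert by auto
  qed simp
  from this[of "P1 \<times> P2"] show ?thesis
    using I(1) finite_P1 finite_P2 by (simp add: Un_absorb1)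
qed

text \<open>Every individual remains an endpoint, so no pair is at distance 3 and only the removed
  pair changes, from distance 1 to 2. The cardinality makes the result a redundant
  structure.\<close>

lemma gain_full_remove:
  assumes p: "p \<in> P1 \<times> P2"
  shows "gain (P1 \<times> P2 - {p}) = gain (P1 \<times> P2) - (f * y3 \<delta> - c)"
    and "2 \<le> card (P1 \<times> P2 - {p})"
proof -
  let ?I = "P1 \<times> P2 - {p}"
  obtain i k where ik: "p = (i, k)" "i \<in> P1" "k \<in> P2" using p by auto
  have "card (P1 - {i}) \<noteq> 0" "card (P2 - {k}) \<noteq> 0"
    using ik card_P1 card_P2 by auto
  \<comment> \<open>Links to \<open>i'\<close> and \<open>k'\<close> keep \<open>k\<close> and
    \<open>i\<close> among the endpoints.\<close>
  then obtain i' k' where i'k': "i' \<in> P1" "i' \<noteq> i" "k' \<in> P2" "k' \<noteq> k"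
    by (metis DiffE card.empty ex_in_conv singletonI)
  have img: "fst ` ?I = P1" "snd ` ?I = P2" "fst ` (P1 \<times> P2) = P1" "snd ` (P1 \<times> P2) = P2"
    using ik i'k' by (force simp: image_iff)+
  have ne: "?I \<noteq> {}" "P1 \<noteq> {}" "P2 \<noteq> {}" using ik i'k' by auto
  have "3 * 3 \<le> card P1 * card P2"
    using card_P1 card_P2 by (intro mult_le_mono)
  then have card: "card ?I = card P1 * card P2 - 1" "9 \<le> card P1 * card P2"
    using p finite_P1 finite_P2 by (simp_all add: card_cartesian_product)
  then show "2 \<le> card ?I" by linarith
  have card_diff: "real (card ?I) = real (card (P1 \<times> P2)) - 1"
    unfolding card(1) using card(2) by (simp add: card_cartesian_product of_nat_diff del: One_nat_def)
  have "gain J = f * (s1 * s2 * \<delta>\<^sup>2 + real (card J) * y3 \<delta>) - c * real (card J)"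
    if "J \<in> {?I, P1 \<times> P2}" for J
  proof -
    have "fst ` J = P1" "snd ` J = P2" "J \<noteq> {}" using that img ne by auto
    then show ?thesis by (simp add: gain_def)
  qed
  then show "gain ?I = gain (P1 \<times> P2) - (f * y3 \<delta> - c)"
    using card_diff by (simp add: left_diff_distrib right_diff_distrib distrib_left)
qed

text \<open>Of the \<open>(S - 1) * (T - 1)\<close> pairs that a single link leaves at distance 3, each further link
  brings at most \<open>S + T - 3\<close> closer. The case split on \<open>a\<close> reflects integrality, without which
  the bound fails.\<close>

lemma covered_pairs_bound:
  fixes a b m S T :: real
  assumes "a = 1 \<or> 2 \<le> a" "1 \<le> b" "a \<le> S" "b \<le> T" "a \<le> m" "b \<le> m" "2 \<le> T"
  shows "(S - 1) * (T - 1) - (S - a) * (T - b) \<le> (m - 1) * (S + T - 3)"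
proof (cases "a = 1")
  case True
  \<comment> \<open>From \<open>b \<le> m\<close> and \<open>2 \<le> T\<close>.\<close>
  have "(S - 1) * (b - 1) \<le> (m - 1) * (S + T - 3)"
    using assms True by (subst mult.commute, intro mult_mono) auto
  then show ?thesis using True by (simp add: algebra_simps)
next
  case False
  \<comment> \<open>The left side becomes \<open>a' * (T - 1 - b') + b' * (S - 1)\<close>. Replacing
    \<open>a'\<close> by \<open>k\<close> leaves the bound on
    \<open>b' * (S - 1 - k)\<close>.\<close>
  define k a' b' where "k = m - 1" and "a' = a - 1" and "b' = b - 1"
  have a': "1 \<le> a'" "a' \<le> k" "0 \<le> b'" "b' \<le> k" "a' \<le> S - 1" "b' \<le> T - 1"
    using assms False by (auto simp: k_def a'_def b'_def)
  have "a' * (T - 1 - b') \<le> k * (T - 1 - b')"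
    using a' by (intro mult_right_mono) auto
  \<comment> \<open>Here \<open>2 \<le> a\<close> enters: it gives \<open>1 \<le> k\<close>, hence
    \<open>S - 1 - k \<le> S - 2\<close>.\<close>
  moreover have "b' * (S - 1 - k) \<le> k * (S - 2)"
  proof (cases "k \<le> S - 1")
    case True
    then show ?thesis using a' by (intro mult_mono) auto
  next
    case False
    then have "b' * (S - 1 - k) \<le> 0" using a' by (intro mult_nonneg_nonpos) auto
    also have "0 \<le> k * (S - 2)" using a' by auto
    finally show ?thesis .
  qed
  ultimately show ?thesis
    by (simp add: k_def a'_def b'_def algebra_simps)
qed

text \<open>Each link beyond the first gains \<open>y3 \<delta>\<close> by itself, and by
  \<open>covered_pairs_bound\<close> at most \<open>s1 + s2 - 3\<close> pairs per further link leave
  distance 3, each worth \<open>\<delta> * y3 \<delta>\<close>.\<close>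

lemma gain_le_single:
  assumes I: "I \<subseteq> P1 \<times> P2" "I \<noteq> {}"
  shows "gain I \<le> gain {p} + (real (card I) - 1) * (f * double_threshold - c)"
proof -
  let ?a = "real (card (fst ` I))" and ?b = "real (card (snd ` I))" and ?m = "real (card I)"
  have "0 < card (fst ` I)" "0 < card (snd ` I)"
    using I(2) ends_bounds(1)[OF I(1)] by (auto simp: card_gt_0_iff)
  then have "?a = 1 \<or> 2 \<le> ?a" "1 \<le> ?b" by auto
  then have "(s1 - 1) * (s2 - 1) - (s1 - ?a) * (s2 - ?b) \<le> (?m - 1) * (s1 + s2 - 3)"
    using ends_bounds[OF I(1)] s2_ge by (intro covered_pairs_bound) auto
  then have "f * (((s1 - 1) * (s2 - 1) - (s1 - ?a) * (s2 - ?b)) * (\<delta> * y3 \<delta>))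
      \<le> f * ((?m - 1) * (s1 + s2 - 3) * (\<delta> * y3 \<delta>))"
    using F_nonneg \<delta>_pos y3_pos by (intro mult_left_mono mult_right_mono) auto
  moreover have "gain {p} = f * (s1 * s2 * \<delta>\<^sup>2 + y3 \<delta> - (s1 - 1) * (s2 - 1) * \<delta> * y3 \<delta>) - c"
    by (simp add: gain_def)
  ultimately show ?thesis
    using I(2) by (simp add: gain_def double_threshold_def algebra_simps)
qed

section \<open>Optimality criteria for the four structures\<close>

lemma two_disjoint_pairs:
  obtains i k i' k' where "i \<in> P1" "i' \<in> P1" "i \<noteq> i'" "k \<in> P2" "k' \<in> P2" "k \<noteq> k'"
proof -
  have "\<exists>x \<in> A. \<exists>y \<in> A. x \<noteq> y" if "3 \<le> card A" for A :: "'a set"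
  proof -
    have "2 \<le> card A" using that by simp
    then obtain B where "B \<subseteq> A" "card B = 2"
      by (rule obtain_subset_with_card_n)
    then show ?thesis by (auto simp: card_2_iff)
  qed
  then show ?thesis
    using that card_P1 card_P2 by metis
qed

text \<open>If the first link does not pay, further ones do not either, since
  \<open>double_threshold \<le> single_threshold\<close>.\<close>

lemma optimal_empty_iff: "optimal {} \<longleftrightarrow> f * single_threshold \<le> c"
proof
  assume opt: "optimal {}"
  obtain i k where "i \<in> P1" "k \<in> P2" by (rule two_disjoint_pairs)
  then have "gain {(i, k)} \<le> gain {}" using opt by (auto simp: optimal_def)
  then show "f * single_threshold \<le> c" by (simp add: gain_empty gain_singleton)
next
  assume c: "f * single_threshold \<le> c"
  obtain I where I: "optimal I" using optimal_exists by auto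
  have "gain I \<le> gain {}"
  proof (cases "I = {}")
    case False
    then have "1 \<le> card I"
      using I ends_bounds(1)[of I] by (simp add: optimal_def card_gt_0_iff Suc_le_eq)
    then have "(real (card I) - 1) * (f * double_threshold - c) \<le> 0"
      using c f_thresholds by (intro mult_nonneg_nonpos) auto
    moreover have "gain {p} \<le> 0" for p
      using c by (simp add: gain_singleton)
    \<comment> \<open>\<open>undefined\<close> stands for an arbitrary \<open>p\<close>; the gain of
      a singleton does not depend on it.\<close>
    ultimately show ?thesis
      using gain_le_single[of I undefined] I False
      unfolding optimal_def gain_empty by (meson add_nonpos_nonpos order_trans)
  qed simp
  then show "optimal {}" using I optimal_trans by blast
qed

text \<open>Comparison with the empty set and with two disjoint links gives necessity;
  \<open>gain_le_single\<close> shows that these competitors decide.\<close>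

lemma optimal_singleton_iff:
  "(\<exists>I. optimal I \<and> card I = 1) \<longleftrightarrow> c \<le> f * single_threshold \<and> f * double_threshold \<le> c"
proof
  assume "\<exists>I. optimal I \<and> card I = 1"
  then obtain p where opt: "optimal {p}" by (auto simp: card_1_singleton_iff)
  obtain i k i' k' where ik: "i \<in> P1" "i' \<in> P1" "i \<noteq> i'" "k \<in> P2" "k' \<in> P2" "k \<noteq> k'"
    by (rule two_disjoint_pairs)
  have "gain {} \<le> gain {p}" "gain {(i, k), (i', k')} \<le> gain {p}"
    using opt ik by (auto simp: optimal_def)
  then show "c \<le> f * single_threshold \<and> f * double_threshold \<le> c"
    unfolding gain_disjoint_pair[OF ik(3,6), of p] by (simp add: gain_empty gain_singleton)
next
  assume c: "c \<le> f * single_threshold \<and> f * double_threshold \<le> c"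
  obtain i k where ik: "i \<in> P1" "k \<in> P2" by (rule two_disjoint_pairs)
  obtain I where I: "optimal I" using optimal_exists by auto
  have "gain I \<le> gain {(i, k)}"
  proof (cases "I = {}")
    case True
    then show ?thesis using c by (simp add: gain_empty gain_singleton)
  next
    case False
    then have "1 \<le> card I"
      using I ends_bounds(1)[of I] by (simp add: optimal_def card_gt_0_iff Suc_le_eq)
    then have "(real (card I) - 1) * (f * double_threshold - c) \<le> 0"
      using c by (intro mult_nonneg_nonpos) auto
    then show ?thesis
      using gain_le_single[of I "(i, k)"] I False unfolding optimal_def by linarith
  qed
  then have "optimal {(i, k)}" using I ik optimal_trans by simp
  then show "\<exists>I. optimal I \<and> card I = 1" by (intro exI[of _ "{(i, k)}"]) simp
qed

text \<open>Removing one link from the full set shows necessity; filling up an optimal set shows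
  sufficiency.\<close>

lemma optimal_full_iff: "optimal (P1 \<times> P2) \<longleftrightarrow> c \<le> f * y3 \<delta>"
proof
  obtain i k where ik: "i \<in> P1" "k \<in> P2" by (rule two_disjoint_pairs)
  {
    assume "optimal (P1 \<times> P2)"
    then have "gain (P1 \<times> P2 - {(i, k)}) \<le> gain (P1 \<times> P2)"
      by (auto simp: optimal_def)
    then show "c \<le> f * y3 \<delta>" using gain_full_remove(1)[of "(i, k)"] ik by simp
  next
    assume c: "c \<le> f * y3 \<delta>"
    obtain I where I: "optimal I" using optimal_exists by auto
    have "gain I \<le> gain (P1 \<times> P2)"
    proof (cases "I = {}")
      case True
      \<comment> \<open>\<open>gain_le_full\<close> needs a nonempty set, so a first link is added;
        it pays because its threshold is the largest.\<close>
      have "c \<le> f * single_threshold"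
        using c f_thresholds by (meson order_trans)
      then have "gain I \<le> gain {(i, k)}"
        by (simp add: True gain_empty gain_singleton)
      also have "\<dots> \<le> gain (P1 \<times> P2)" using ik c by (intro gain_le_full) auto
      finally show ?thesis .
    next
      case False
      then show ?thesis using I c by (intro gain_le_full) (auto simp: optimal_def)
    qed
    then show "optimal (P1 \<times> P2)" using I optimal_trans by blast
  }
qed

text \<open>For necessity, \<open>I\<close> is compared with itself plus a missing link and with a
  singleton. Conversely, an optimal set with at most one link is matched by two disjoint links, and
  the full set by the full set minus one link.\<close>

lemma optimal_redundant_iff:
  "(\<exists>I. optimal I \<and> 2 \<le> card I \<and> I \<noteq> P1 \<times> P2) \<longleftrightarrow>
    c \<le> f * double_threshold \<and> f * y3 \<delta> \<le> c"
proof
  obtain i k i' k' where ik: "i \<in> P1" "i' \<in> P1" "i \<noteq> i'" "k \<in> P2" "k' \<in> P2" "k \<noteq> k'"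
    by (rule two_disjoint_pairs)
  {
    assume "\<exists>I. optimal I \<and> 2 \<le> card I \<and> I \<noteq> P1 \<times> P2"
    then obtain I where I: "I \<subseteq> P1 \<times> P2" "\<And>J. J \<subseteq> P1 \<times> P2 \<Longrightarrow> gain J \<le> gain I"
      and two: "2 \<le> card I" and "I \<noteq> P1 \<times> P2" by (auto simp: optimal_def)
    then obtain p where p: "p \<in> P1 \<times> P2" "p \<notin> I" by blast
    have ne: "I \<noteq> {}" using two by auto
    have "gain (insert p I) \<le> gain I" using I p by auto
    then have "f * y3 \<delta> \<le> c" using gain_insert[OF I(1) ne p] by simp
    moreover have "gain {(i, k)} \<le> gain I" using I(2) ik by simp
    then have "0 \<le> (real (card I) - 1) * (f * double_threshold - c)"
      using gain_le_single[OF I(1) ne, of "(i, k)"] by linarith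
    then have "c \<le> f * double_threshold" using two by (simp add: zero_le_mult_iff)
    ultimately show "c \<le> f * double_threshold \<and> f * y3 \<delta> \<le> c" by simp
  next
    assume c: "c \<le> f * double_threshold \<and> f * y3 \<delta> \<le> c"
    let ?D = "{(i, k), (i', k')}"
    \<comment> \<open>The pair \<open>(i, k')\<close> witnesses that \<open>?D\<close> is not the
      full set.\<close>
    have D: "?D \<subseteq> P1 \<times> P2" "card ?D = 2" "(i, k') \<in> P1 \<times> P2 - ?D" using ik by auto
    obtain I where I: "optimal I" using optimal_exists by auto
    then have finI: "finite I" using ends_bounds(1) by (simp add: optimal_def)
    consider "card I \<le> 1" | "2 \<le> card I" "I \<noteq> P1 \<times> P2" | "I = P1 \<times> P2"
      by linarith
    then show "\<exists>I. optimal I \<and> 2 \<le> card I \<and> I \<noteq> P1 \<times> P2"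
    proof cases
      case 1
      have "0 \<le> gain {p}" for p
        using c f_thresholds(2) unfolding gain_singleton by linarith
      moreover have "I = {} \<or> (\<exists>p. I = {p})"
        using 1 finI by (metis One_nat_def card_0_eq card_1_singletonE le_SucE le_zero_eq)
      \<comment> \<open>Neither the first link nor the second, disjoint one is added at a
        loss.\<close>
      ultimately have "gain I \<le> gain ?D"
        using c gain_disjoint_pair[OF ik(3,6)] gain_empty
        by (smt (verit))
      then have "optimal ?D" using I D(1) optimal_trans by blast
      then show ?thesis using D(2,3) by (intro exI[of _ ?D]) auto
    next
      case 2
      then show ?thesis using I by blast
    next
      case 3
      let ?J = "P1 \<times> P2 - {(i, k)}"
      have "gain I \<le> gain ?J" using gain_full_remove(1)[of "(i, k)"] ik c 3 by simp
      then have "optimal ?J" using I optimal_trans by blast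
      moreover have "2 \<le> card ?J" using gain_full_remove(2)[of "(i, k)"] ik by simp
      moreover have "?J \<noteq> P1 \<times> P2" using ik by blast
      ultimately show ?thesis by blast
    qed
  }
qed

section \<open>The bounds as quotients, and transfer to efficient networks\<close>

lemma single_threshold_iff:
  "c * \<delta> / (y1 \<delta> (card P1) * y1 \<delta> (card P2)) \<le> f \<longleftrightarrow> c \<le> f * single_threshold"
  "f \<le> c * \<delta> / (y1 \<delta> (card P1) * y1 \<delta> (card P2)) \<longleftrightarrow> f * single_threshold \<le> c"
proof -
  have "0 < y1 \<delta> (card P1)" "0 < y1 \<delta> (card P2)"
    using \<delta>_pos s1_ge s2_ge by (auto simp: y1_eq intro!: mult_pos_pos add_pos_nonneg)
  \<comment> \<open>Only the denominator must be positive for the equivalences, so they hold for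
    either sign of \<open>c\<close>.\<close>
  then have "0 < y1 \<delta> (card P1) * y1 \<delta> (card P2)" by simp
  then show "c * \<delta> / (y1 \<delta> (card P1) * y1 \<delta> (card P2)) \<le> f \<longleftrightarrow> c \<le> f * single_threshold"
    "f \<le> c * \<delta> / (y1 \<delta> (card P1) * y1 \<delta> (card P2)) \<longleftrightarrow> f * single_threshold \<le> c"
    using \<delta>_pos by (simp_all add: single_threshold_def pos_divide_le_eq pos_le_divide_eq)
qed

lemma double_threshold_iff:
  defines "D \<equiv> y2 \<delta> (card P2) + y2 \<delta> (card P1) + (s1 + s2 - 4) * \<delta> * y3 \<delta>"
  shows "2 * c / D \<le> f \<longleftrightarrow> c \<le> f * double_threshold"
    and "f \<le> 2 * c / D \<longleftrightarrow> f * double_threshold \<le> c"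
proof -
  \<comment> \<open>Both \<open>y2\<close> terms contain the factor \<open>y3 \<delta>\<close>;
    collecting it leaves \<open>2 + 2 * (s1 + s2 - 3) * \<delta>\<close>.\<close>
  have D: "D = 2 * double_threshold"
    unfolding D_def double_threshold_def y2_def y1_eq y3_eq by (simp add: algebra_simps)
  have "0 < double_threshold" using y3_pos y3_le_double_threshold by linarith
  then show "2 * c / D \<le> f \<longleftrightarrow> c \<le> f * double_threshold"
    "f \<le> 2 * c / D \<longleftrightarrow> f * double_threshold \<le> c"
    unfolding D by (simp_all add: pos_divide_le_eq pos_le_divide_eq)
qed

lemma y3_threshold_iff:
  "c / y3 \<delta> \<le> f \<longleftrightarrow> c \<le> f * y3 \<delta>" "f \<le> c / y3 \<delta> \<longleftrightarrow> f * y3 \<delta> \<le> c"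
  using y3_pos by (simp_all add: pos_divide_le_eq pos_le_divide_eq)

lemma ex_efficient_iff:
  assumes "\<And>I. I \<subseteq> P1 \<times> P2 \<Longrightarrow> Q (joined_cliques I) \<longleftrightarrow> R I"
  shows "(\<exists>E. efficient F \<delta> c P1 P2 E \<and> Q E) \<longleftrightarrow> (\<exists>I. optimal I \<and> R I)"
  using assms by (auto simp: efficient_iff_optimal optimal_def)

lemma efficient_disjoint_iff:
  "(\<exists>E. efficient F \<delta> c P1 P2 E \<and> disjoint_union_of_cliques P1 P2 E) \<longleftrightarrow>
    f * single_threshold \<le> c"
  by (subst ex_efficient_iff[where R = "\<lambda>I. I = {}"])
    (simp_all add: disjoint_joined_cliques optimal_empty_iff)

lemma efficient_minimally_iff:
  "(\<exists>E. efficient F \<delta> c P1 P2 E \<and> minimally_connected_cliques P1 P2 E) \<longleftrightarrow>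
    c \<le> f * single_threshold \<and> f * double_threshold \<le> c"
  by (subst ex_efficient_iff[where R = "\<lambda>I. card I = 1"])
    (simp_all only: minimally_joined_cliques optimal_singleton_iff)

text \<open>The maximal structure is excluded explicitly because it also counts as redundantly
  connected.\<close>

lemma efficient_redundantly_iff:
  "(\<exists>E. efficient F \<delta> c P1 P2 E \<and> redundantly_connected_cliques P1 P2 E \<and>
      \<not> maximally_connected_cliques P1 P2 E) \<longleftrightarrow>
    c \<le> f * double_threshold \<and> f * y3 \<delta> \<le> c"
  by (subst ex_efficient_iff[where R = "\<lambda>I. 2 \<le> card I \<and> I \<noteq> P1 \<times> P2"])
    (simp_all add: redundantly_joined_cliques maximally_joined_cliques optimal_redundant_iff)

lemma efficient_maximally_iff:
  "(\<exists>E. efficient F \<delta> c P1 P2 E \<and> maximally_connected_cliques P1 P2 E) \<longleftrightarrow> c \<le> f * y3 \<delta>"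
  by (subst ex_efficient_iff[where R = "\<lambda>I. I = P1 \<times> P2"])
    (simp_all add: maximally_joined_cliques optimal_full_iff)

end

text \<open>Each case asserts the existence of an efficient network of the given structure, since at
  a common bound both adjacent structures are efficient. By the first conjunct every efficient
  network has one of the four structures.\<close>

theorem mainTheorem4:
  fixes V P1 P2 :: "'a set" and n s1 s2 :: nat
    and F :: "real ^ 2 ^ 2" and \<delta> c :: real
  assumes "finite V" and "card V = n"
    and "P1 \<union> P2 = V" and "P1 \<inter> P2 = {}"
    and "card P1 = s1" and "card P2 = s2" and "s1 \<ge> 3" and "s2 \<ge> 3"
    and "transpose F = F" and "\<And>\<alpha> \<beta>. 0 \<le> F $ \<alpha> $ \<beta> \<and> F $ \<alpha> $ \<beta> \<le> 1"
    and "\<And>\<alpha>. F $ \<alpha> $ \<alpha> = 1"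
    and "0 < \<delta>" and "\<delta> < 1" and "c < y3 \<delta>"
  shows
    "(\<forall>E. efficient F \<delta> c P1 P2 E \<longrightarrow> clique P1 E \<and> clique P2 E) \<and>
     ((\<exists>E. efficient F \<delta> c P1 P2 E \<and> disjoint_union_of_cliques P1 P2 E) \<longleftrightarrow>
        0 \<le> F $ 1 $ 2 \<and> F $ 1 $ 2 \<le> c * \<delta> / (y1 \<delta> s1 * y1 \<delta> s2)) \<and>
     ((\<exists>E. efficient F \<delta> c P1 P2 E \<and> minimally_connected_cliques P1 P2 E) \<longleftrightarrow>
        c * \<delta> / (y1 \<delta> s1 * y1 \<delta> s2) \<le> F $ 1 $ 2 \<and>
        F $ 1 $ 2 \<le> 2 * c / (y2 \<delta> s2 + y2 \<delta> s1 + (real s1 + real s2 - 4) * \<delta> * y3 \<delta>)) \<and>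
     ((\<exists>E. efficient F \<delta> c P1 P2 E \<and> redundantly_connected_cliques P1 P2 E \<and>
           \<not> maximally_connected_cliques P1 P2 E) \<longleftrightarrow>
        2 * c / (y2 \<delta> s2 + y2 \<delta> s1 + (real s1 + real s2 - 4) * \<delta> * y3 \<delta>) \<le> F $ 1 $ 2 \<and>
        F $ 1 $ 2 \<le> c / y3 \<delta>) \<and>
     ((\<exists>E. efficient F \<delta> c P1 P2 E \<and> maximally_connected_cliques P1 P2 E) \<longleftrightarrow>
        c / y3 \<delta> \<le> F $ 1 $ 2 \<and> F $ 1 $ 2 \<le> 1)"
proof -
  interpret two_groups P1 P2 F \<delta> c
  proof unfold_locales
    show "finite P1" "finite P2"
      using assms(1,3) by (metis finite_Un)+
  qed (use assms in simp_all)
  have "0 \<le> F $ 1 $ 2" "F $ 1 $ 2 \<le> 1"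
    using assms(10) by auto
  then show ?thesis
    unfolding assms(5,6)[symmetric] single_threshold_iff double_threshold_iff y3_threshold_iff
      efficient_disjoint_iff efficient_minimally_iff efficient_redundantly_iff
      efficient_maximally_iff
    using efficient_imp_cliques by auto
qed

end
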